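(* Let $m\in\mathbb{N}$, $1\le p<q\le\infty$ (with $\frac pq=0$ if $q=\infty$), and let $A$ be a randomized algorithm with $$e(A,\ell_p^m\hookrightarrow\ell_\infty^m)\le C\cdot\varepsilon,$$ where $C\ge1$ and $\varepsilon>0$. For $\mathbf{x}\in\mathbb{R}^m$ denote the corresponding output by $\mathbf{z}:=A(\mathbf{x})$. Define $k:=\min\{\lfloor\varepsilon^{-p}\rfloor,m\}$ and choose a $k$-element set $I_k=I_k(\mathbf{z})\subseteq[m]$ satisfying $$\min_{i\in I_k}|z_i|\ge\max_{i\in[m]\setminus I_k}|z_i|.$$ Based on this, define the denoised algorithm $D$ with output $\mathbf{w}=D(\mathbf{x})$, where $w_i=z_i$ if $i\in I_k(\mathbf{z})$ and $w_i=0$ otherwise. Then $$\tfrac13\,\varepsilon^{1-\frac pq}\le e(D,\ell_p^m\hookrightarrow\ell_q^m)\le(1+5C)\cdot\varepsilon^{1-\frac pq},$$ where the lower bound holds under the additional assumption $2k+1\le m$. Moreover, $\operatorname{card}D=\operatorname{card}A$.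
   Context: $[m]=\{1,\dots,m\}$. A randomized algorithm is a family $A=(A^\omega)_{\omega\in\Omega}$ of maps $A^\omega:\mathbb{R}^m\to\mathbb{R}^m$ indexed by a probability space $(\Omega,\Sigma,\mathbb{P})$ (with $A(\mathbf{x}):\omega\mapsto A^\omega(\mathbf{x})$ a random variable for each $\mathbf{x}$), where the output is computed as follows: linear functionals $L_1,L_2,\dots$ on $\mathbb{R}^m$ are evaluated one after another, $y_i=L_i(\mathbf{x})$; the choice of $L_i$ and the decision to stop may depend on $\omega$ and on $y_1,\dots,y_{i-1}$; after a finite number $\kappa=\kappa(\omega,\mathbf{x})$ of evaluations the output is $A^\omega(\mathbf{x})=\phi(y_1,\dots,y_\kappa)$, where $\phi$ may depend on $\omega$. The cardinality is $\operatorname{card}A=\sup_{\omega,\mathbf{x}}\kappa(\omega,\mathbf{x})$, and for $1\le p<q\le\infty$ the error is $e(A,\ell_p^m\hookrightarrow\ell_q^m)=\sup_{\|\mathbf{x}\|_p\le1}\mathbb{E}\,\|\mathbf{x}-A(\mathbf{x})\|_q$. The algorithm $D$ uses exactly the measurements of $A$ and only post-processes its output.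
   Formalization: The lower bound is stated under the further assumption k ≥ 1 (that is, ε ≤ 1); for k = 0 the algorithm D outputs 0 and e(D) = 1, so the lower bound fails for large ε (e.g. A = 0, C = 1, q = ∞, ε = 10). *)

theory Defs
  imports "HOL-Probability.Probability" "HOL-Library.Extended_Nat"
begin

definition lp_norm :: "ereal \<Rightarrow> real ^ 'n::finite \<Rightarrow> real" where
  "lp_norm q x =
     (if q = \<infinity> then Max (range (\<lambda>i. \<bar>x $ i\<bar>))
      else (\<Sum>i\<in>UNIV. \<bar>x $ i\<bar> powr real_of_ereal q) powr (1 / real_of_ereal q))"

text \<open>
  An adaptive randomized algorithm on the coordinate space indexed by \<open>'n\<close>.  Given the random
  element and the list of measurements obtained so far, \<open>query\<close> is either the next functional
  to be evaluated, or \<open>None\<close> if the algorithm stops; \<open>out\<close> computes the output from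
  the final list of measurements.
\<close>

record ('w, 'n::finite) alg =
  query :: "'w \<Rightarrow> real list \<Rightarrow> (real ^ 'n \<Rightarrow> real) option"
  out :: "'w \<Rightarrow> real list \<Rightarrow> real ^ 'n"

text \<open>The measurements of \<open>x\<close> after at most \<open>i\<close> evaluations; constant in \<open>i\<close> once stopped.\<close>

primrec transcript :: "('w, 'n::finite) alg \<Rightarrow> 'w \<Rightarrow> real ^ 'n \<Rightarrow> nat \<Rightarrow> real list" where
  "transcript A \<omega> x 0 = []"
| "transcript A \<omega> x (Suc i) =
     (case query A \<omega> (transcript A \<omega> x i) of
        None \<Rightarrow> transcript A \<omega> x i
      | Some L \<Rightarrow> transcript A \<omega> x i @ [L x])"

text \<open>Meaningful only if the algorithm stops on \<open>x\<close>, as \<open>randomized_algorithm\<close> requires.\<close>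

definition num_evals :: "('w, 'n::finite) alg \<Rightarrow> 'w \<Rightarrow> real ^ 'n \<Rightarrow> nat" where
  "num_evals A \<omega> x = (LEAST i. query A \<omega> (transcript A \<omega> x i) = None)"

definition run :: "('w, 'n::finite) alg \<Rightarrow> 'w \<Rightarrow> real ^ 'n \<Rightarrow> real ^ 'n" where
  "run A \<omega> x = out A \<omega> (transcript A \<omega> x (num_evals A \<omega> x))"

definition randomized_algorithm :: "'w measure \<Rightarrow> ('w, 'n::finite) alg \<Rightarrow> bool" where
  "randomized_algorithm M A \<longleftrightarrow>
     prob_space M \<and>
     (\<forall>\<omega>\<in>space M. \<forall>ys L. query A \<omega> ys = Some L \<longrightarrow> linear L) \<and>
     (\<forall>\<omega>\<in>space M. \<forall>x. \<exists>i. query A \<omega> (transcript A \<omega> x i) = None) \<and>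
     (\<forall>x. (\<lambda>\<omega>. run A \<omega> x) \<in> borel_measurable M)"

definition alg_card :: "'w measure \<Rightarrow> ('w, 'n::finite) alg \<Rightarrow> enat" where
  "alg_card M A = (SUP \<omega>\<in>space M. SUP x. enat (num_evals A \<omega> x))"

text \<open>
  The Lebesgue integral is the expectation whenever the error is a random variable, in particular
  for randomized algorithms.  For a post-processing that breaks measurability, it is the
  corresponding lower integral.
\<close>

definition alg_error :: "'w measure \<Rightarrow> ('w, 'n::finite) alg \<Rightarrow> ereal \<Rightarrow> ereal \<Rightarrow> ennreal" where
  "alg_error M A p q =
     (SUP x\<in>{x. lp_norm p x \<le> 1}. \<integral>\<^sup>+\<omega>. ennreal (lp_norm q (x - run A \<omega> x)) \<partial>M)"

text \<open>
  The infimum and supremum are taken in the extended reals, so the comparison holds trivially when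
  \<open>I z\<close> or its complement is empty.
\<close>

definition top_selection :: "nat \<Rightarrow> (real ^ 'n::finite \<Rightarrow> 'n set) \<Rightarrow> bool" where
  "top_selection k I \<longleftrightarrow>
     (\<forall>z. card (I z) = k \<and> (INF i\<in>I z. ereal \<bar>z $ i\<bar>) \<ge> (SUP i\<in>- I z. ereal \<bar>z $ i\<bar>))"

definition denoise :: "(real ^ 'n::finite \<Rightarrow> 'n set) \<Rightarrow> ('w, 'n) alg \<Rightarrow> ('w, 'n) alg" where
  "denoise I A =
     A\<lparr>out := (\<lambda>\<omega> ys. let z = out A \<omega> ys in (\<chi> i. if i \<in> I z then z $ i else 0))\<rparr>"

end

theory Submission
  imports Defs
begin

text \<open>
  Write \<open>\<delta> = lp_norm \<infinity> (x - z)\<close> for the uniform error of the output \<open>z\<close> on an input \<open>x\<close> of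
  the unit ball of the \<open>p\<close>-norm, \<open>J\<close> for the set of retained coordinates, and \<open>w\<close> for the
  denoised output.

  The upper bound holds for each fixed random element before any expectation is taken. At most
  \<open>k\<close> coordinates of \<open>x\<close> have modulus at least \<open>\<epsilon>\<close>; let \<open>S\<close> be the set of these. If \<open>S\<close>
  contains a discarded coordinate \<open>i\<close>, then, because \<open>J\<close> has \<open>k\<close> elements, some retained
  coordinate \<open>j\<close> lies outside \<open>S\<close>, and \<open>z\<close> is at least as large at \<open>j\<close> as at \<open>i\<close>. Since
  \<open>z\<close> is \<open>\<delta>\<close>-close to \<open>x\<close>, this forces \<open>\<bar>x $ i\<bar> \<le> \<epsilon> + 2 * \<delta>\<close>. Hence in every coordinate
  the modulus of \<open>x - w\<close> is at most \<open>min \<bar>x $ i\<bar> \<epsilon>\<close>, plus \<open>2 * \<delta>\<close> if the coordinate belongs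
  to \<open>J \<union> S\<close>. Interpolation between the \<open>p\<close>-norm and the supremum norm bounds the \<open>q\<close>-norm of
  the first part by \<open>\<epsilon> powr (1 - p / q)\<close>; the second part lives on at most
  \<open>2 * \<epsilon> powr (- p)\<close> coordinates, so its \<open>q\<close>-norm is at most
  \<open>4 * \<delta> * \<epsilon> powr (- p / q)\<close>. This is \<open>keep_largest_error_le\<close>. Its right-hand side is affine in
  \<open>\<delta>\<close>, whose expectation is at most \<open>C * \<epsilon>\<close>, and integration gives the constant
  \<open>1 + 4 * C\<close>.

  The lower bound comes from sparsity: \<open>w\<close> has at most \<open>k\<close> nonzero coordinates. A normalized vector
  that is constant on \<open>2 * k + 1\<close> coordinates keeps its full value on at least \<open>k + 1\<close> of them
  after subtraction of any such \<open>w\<close> (\<open>sparse_approximation_error_ge\<close>). A single input is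
  therefore bad for every random element, and its expected error inherits the pointwise bound.
\<close>

section \<open>Norms on coordinate space\<close>

lemma lp_norm_ereal:
  "lp_norm (ereal r) x = (\<Sum>i\<in>UNIV. \<bar>x $ i\<bar> powr r) powr (1 / r)"
  by (simp add: lp_norm_def)

lemma lp_norm_infinity_le_iff:
  fixes x :: "real ^ 'n::finite"
  shows "lp_norm \<infinity> x \<le> b \<longleftrightarrow> (\<forall>i. \<bar>x $ i\<bar> \<le> b)"
  by (simp add: lp_norm_def)

lemma lp_norm_ereal_le_iff:
  assumes "0 < r" and "0 \<le> b"
  shows "lp_norm (ereal r) x \<le> b \<longleftrightarrow> (\<Sum>i\<in>UNIV. \<bar>x $ i\<bar> powr r) \<le> b powr r"
proof -
  let ?s = "\<Sum>i\<in>UNIV. \<bar>x $ i\<bar> powr r"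
  have s: "0 \<le> ?s" by (simp add: sum_nonneg)
  have eq: "(?s powr (1 / r)) powr r = ?s"
    using assms s by (simp add: powr_powr)
  show ?thesis
  proof
    assume "lp_norm (ereal r) x \<le> b"
    then have "(?s powr (1 / r)) powr r \<le> b powr r"
      using assms by (intro powr_mono2) (auto simp: lp_norm_ereal)
    then show "?s \<le> b powr r" unfolding eq .
  next
    assume "?s \<le> b powr r"
    then have "?s powr (1 / r) \<le> (b powr r) powr (1 / r)"
      using assms s by (intro powr_mono2) auto
    then show "lp_norm (ereal r) x \<le> b"
      using assms by (simp add: lp_norm_ereal powr_powr)
  qed
qed

lemma lp_norm_nonneg: "0 \<le> lp_norm q x"
proof (cases "q = \<infinity>")
  case True
  have "0 \<le> \<bar>x $ undefined\<bar>" by simp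
  also have "\<dots> \<le> lp_norm q x" using True by (simp add: lp_norm_def)
  finally show ?thesis .
qed (simp add: lp_norm_def)

lemma ereal_exponent_cases:
  assumes "1 \<le> (q :: ereal)"
  obtains (finite) r where "q = ereal r" "1 \<le> r" | (infinite) "q = \<infinity>"
  using assms by (cases q) auto

lemma lp_norm_mono:
  assumes "1 \<le> q" and "\<And>i. \<bar>x $ i\<bar> \<le> \<bar>y $ i\<bar>"
  shows "lp_norm q x \<le> lp_norm q y"
  using assms(1)
proof (cases rule: ereal_exponent_cases)
  case (finite r)
  have "(\<Sum>i\<in>UNIV. \<bar>x $ i\<bar> powr r) \<le> (\<Sum>i\<in>UNIV. \<bar>y $ i\<bar> powr r)"
    using finite assms(2) by (intro sum_mono powr_mono2) auto
  then show ?thesis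
    using finite by (simp add: lp_norm_ereal powr_mono2 sum_nonneg)
next
  case infinite
  have "\<bar>y $ i\<bar> \<le> lp_norm \<infinity> y" for i
    using lp_norm_infinity_le_iff[of y "lp_norm \<infinity> y"] by simp
  then show ?thesis
    using infinite assms(2) by (auto simp: lp_norm_infinity_le_iff intro: order_trans)
qed

lemma lp_norm_eq_0_iff:
  assumes "1 \<le> r"
  shows "lp_norm (ereal r) x = 0 \<longleftrightarrow> x = 0"
  using assms by (auto simp: lp_norm_ereal sum_nonneg_eq_0_iff vec_eq_iff)

text \<open>
  The closed half-line is needed because coordinates may vanish; at the endpoint \<open>0\<close> convexity
  reduces to \<open>t powr r \<le> t\<close> for \<open>t\<close> between \<open>0\<close> and \<open>1\<close>.
\<close>

lemma powr_convex_nonneg: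
  fixes r :: real
  assumes "1 \<le> r"
  shows "convex_on {0..} (\<lambda>u. u powr r)"
proof (rule convex_onI)
  fix t x y :: real
  assume t: "0 < t" "t < 1" and xy: "x \<in> {0..}" "y \<in> {0..}"
  have pull: "(c * u) powr r \<le> c * u powr r" if "0 < c" "c < 1" "0 \<le> u" for c u :: real
    using that assms powr_mono'[of 1 r c] by (simp add: powr_mult mult_right_mono)
  show "((1 - t) *\<^sub>R x + t *\<^sub>R y) powr r \<le> (1 - t) * x powr r + t * y powr r"
  proof (cases "x = 0 \<or> y = 0")
    case True
    then show ?thesis using t xy pull[of t y] pull[of "1 - t" x] assms by auto
  next
    case False
    then show ?thesis
      using convex_onD[OF powr_convex[OF assms], of t x y] t xy by simp
  qed
qed simp

text \<open>
  Minkowski's inequality. With \<open>a\<close> and \<open>b\<close> the two norms, \<open>\<bar>x $ i\<bar> + \<bar>y $ i\<bar>\<close> is \<open>a + b\<close> times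
  the convex combination of \<open>\<bar>x $ i\<bar> / a\<close> and \<open>\<bar>y $ i\<bar> / b\<close> with weights \<open>a / (a + b)\<close> and
  \<open>b / (a + b)\<close>; convexity of the power function, summed over the coordinates, gives the claim
  because both normalized vectors have norm \<open>1\<close>.
\<close>

lemma lp_norm_triangle:
  assumes "1 \<le> q"
  shows "lp_norm q (x + y) \<le> lp_norm q x + lp_norm q y"
  using assms
proof (cases rule: ereal_exponent_cases)
  case (finite r)
  show ?thesis
  proof (cases "x = 0 \<or> y = 0")
    case True
    then show ?thesis using lp_norm_nonneg by auto
  next
    case False
    define a where "a = lp_norm q x"
    define b where "b = lp_norm q y"
    have pos: "0 < a" "0 < b"
      using False lp_norm_eq_0_iff[OF finite(2)] lp_norm_nonneg[of q] finite(1)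
      unfolding a_def b_def by (metis less_eq_real_def)+
    define t where "t = a / (a + b)"
    have t: "0 \<le> t" "0 \<le> 1 - t" "1 - t = b / (a + b)"
      using pos by (auto simp: t_def field_simps)
    have coord: "\<bar>(x + y) $ i\<bar> powr r
        \<le> (a + b) powr r * (t * (\<bar>x $ i\<bar> powr r / a powr r)
            + (1 - t) * (\<bar>y $ i\<bar> powr r / b powr r))" for i
    proof -
      have eq: "\<bar>x $ i\<bar> + \<bar>y $ i\<bar> = (a + b) * (t * (\<bar>x $ i\<bar> / a) + (1 - t) * (\<bar>y $ i\<bar> / b))"
      proof -
        have "(a + b) * t = a" "(a + b) * (1 - t) = b"
          using pos unfolding t(3) by (simp_all add: t_def)
        then show ?thesis
          using pos by (simp add: distrib_left flip: mult.assoc)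
      qed
      have cvx: "convex_on {0..} (\<lambda>u. u powr r)" using finite(2) by (rule powr_convex_nonneg)
      have "\<bar>(x + y) $ i\<bar> powr r \<le> (\<bar>x $ i\<bar> + \<bar>y $ i\<bar>) powr r"
        using finite(2) by (intro powr_mono2) auto
      also have "\<dots> = (a + b) powr r * (t * (\<bar>x $ i\<bar> / a) + (1 - t) * (\<bar>y $ i\<bar> / b)) powr r"
        unfolding eq by (rule powr_mult)
      also have "\<dots> \<le> (a + b) powr r * (t * (\<bar>x $ i\<bar> / a) powr r + (1 - t) * (\<bar>y $ i\<bar> / b) powr r)"
        using convex_onD[OF cvx, of "1 - t" "\<bar>x $ i\<bar> / a" "\<bar>y $ i\<bar> / b"] t(1,2) pos
        by (intro mult_left_mono) auto
      finally show ?thesis using pos by (simp add: powr_divide)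
    qed
    have sums: "(\<Sum>i\<in>UNIV. \<bar>x $ i\<bar> powr r) \<le> a powr r" "(\<Sum>i\<in>UNIV. \<bar>y $ i\<bar> powr r) \<le> b powr r"
      using pos finite by (auto simp: a_def b_def simp flip: lp_norm_ereal_le_iff)
    have "(\<Sum>i\<in>UNIV. \<bar>(x + y) $ i\<bar> powr r) \<le>
        (a + b) powr r * (t * ((\<Sum>i\<in>UNIV. \<bar>x $ i\<bar> powr r) / a powr r)
          + (1 - t) * ((\<Sum>i\<in>UNIV. \<bar>y $ i\<bar> powr r) / b powr r))"
      by (rule order_trans[OF sum_mono[OF coord]])
        (simp add: sum.distrib sum_divide_distrib del: times_divide_eq_right
          flip: sum_distrib_left)
    also have "\<dots> \<le> (a + b) powr r * (t * 1 + (1 - t) * 1)"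
      using pos sums t by (intro mult_left_mono add_mono) auto
    finally show ?thesis
      using lp_norm_ereal_le_iff[of r "a + b" "x + y"] pos finite unfolding a_def b_def by simp
  qed
next
  case infinite
  have bound: "\<bar>z $ i\<bar> \<le> lp_norm \<infinity> z" for i and z :: "real ^ 'a"
    using lp_norm_infinity_le_iff[of z "lp_norm \<infinity> z"] by simp
  show ?thesis
    unfolding infinite lp_norm_infinity_le_iff
    using bound[of x] bound[of y] by (auto intro: order_trans[OF abs_triangle_ineq] add_mono)
qed

text \<open>
  Coordinates bounded by \<open>\<epsilon>\<close> satisfy
  \<open>\<bar>x $ i\<bar> powr q \<le> \<epsilon> powr (q - p) * \<bar>x $ i\<bar> powr p\<close>, and the last factors sum to at most \<open>1\<close>.
\<close>

lemma lp_norm_interpolation: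
  assumes "1 \<le> p" and "ereal p < q" and "0 < \<epsilon>"
    and "lp_norm (ereal p) x \<le> 1" and "\<And>i. \<bar>x $ i\<bar> \<le> \<epsilon>"
  shows "lp_norm q x \<le> \<epsilon> powr (1 - real_of_ereal (ereal p / q))"
proof (cases q)
  case (real r)
  then have r: "p < r" "0 < r" using assms by auto
  have sum1: "(\<Sum>i\<in>UNIV. \<bar>x $ i\<bar> powr p) \<le> 1"
    using assms lp_norm_ereal_le_iff[of p 1 x] by simp
  have coord: "\<bar>x $ i\<bar> powr r \<le> \<epsilon> powr (r - p) * \<bar>x $ i\<bar> powr p" for i
  proof -
    have "\<bar>x $ i\<bar> powr r = \<bar>x $ i\<bar> powr (r - p) * \<bar>x $ i\<bar> powr p"
      by (simp flip: powr_add)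
    also have "\<dots> \<le> \<epsilon> powr (r - p) * \<bar>x $ i\<bar> powr p"
      using assms r by (intro mult_right_mono powr_mono2) auto
    finally show ?thesis .
  qed
  have "(\<Sum>i\<in>UNIV. \<bar>x $ i\<bar> powr r) \<le> \<epsilon> powr (r - p) * (\<Sum>i\<in>UNIV. \<bar>x $ i\<bar> powr p)"
    using sum_mono[OF coord] by (simp add: sum_distrib_left)
  also have "\<dots> \<le> \<epsilon> powr (r - p) * 1"
    using sum1 by (intro mult_left_mono) auto
  also have "\<dots> = (\<epsilon> powr (1 - p / r)) powr r"
    using r by (simp add: powr_powr left_diff_distrib)
  finally show ?thesis
    using real r by (simp add: lp_norm_ereal_le_iff)
qed (use assms in \<open>auto simp: lp_norm_infinity_le_iff\<close>)

text \<open>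
  Using \<open>real_of_ereal (1 / q)\<close>, which is \<open>0\<close> for \<open>q = \<infinity>\<close>, as the exponent of the cardinality
  makes one formula serve finite and infinite \<open>q\<close>.
\<close>

lemma lp_norm_supported_le:
  fixes x :: "real ^ 'n::finite"
  assumes "1 \<le> q" and "0 \<le> c"
    and "\<And>i. i \<in> S \<Longrightarrow> \<bar>x $ i\<bar> \<le> c" and "\<And>i. i \<notin> S \<Longrightarrow> x $ i = 0"
  shows "lp_norm q x \<le> real (card S) powr real_of_ereal (1 / q) * c"
  using assms(1)
proof (cases rule: ereal_exponent_cases)
  case (finite r)
  have "(\<Sum>i\<in>UNIV. \<bar>x $ i\<bar> powr r) = (\<Sum>i\<in>S. \<bar>x $ i\<bar> powr r)"
    using assms(4) by (intro sum.mono_neutral_right) auto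
  also have "\<dots> \<le> (\<Sum>i\<in>S. c powr r)"
    using assms finite by (intro sum_mono powr_mono2) auto
  also have "\<dots> = (real (card S) powr (1 / r) * c) powr r"
    using assms finite by (simp add: powr_mult powr_powr)
  finally show ?thesis
    using assms finite by (simp add: lp_norm_ereal_le_iff one_ereal_def)
next
  case infinite
  show ?thesis
  proof (cases "S = {}")
    case True
    then have "x $ i = 0" for i using assms(4) by auto
    then show ?thesis using True infinite by (simp add: lp_norm_infinity_le_iff)
  next
    case False
    then have "card S \<noteq> 0" by (simp add: card_eq_0_iff)
    then have "real (card S) powr real_of_ereal (1 / q) * c = c" using infinite by simp
    moreover have "\<bar>x $ i\<bar> \<le> c" for i using assms by (cases "i \<in> S") auto
    ultimately show ?thesis using False unfolding infinite lp_norm_infinity_le_iff by simp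
  qed
qed

lemma lp_norm_ge_on_set:
  fixes x :: "real ^ 'n::finite"
  assumes "1 \<le> q" and "0 \<le> c" and "S \<noteq> {}" and "\<And>i. i \<in> S \<Longrightarrow> c \<le> \<bar>x $ i\<bar>"
  shows "real (card S) powr real_of_ereal (1 / q) * c \<le> lp_norm q x"
  using assms(1)
proof (cases rule: ereal_exponent_cases)
  case (finite r)
  have "(\<Sum>i\<in>S. c powr r) \<le> (\<Sum>i\<in>S. \<bar>x $ i\<bar> powr r)"
    using assms finite by (intro sum_mono powr_mono2) auto
  also have "\<dots> \<le> (\<Sum>i\<in>UNIV. \<bar>x $ i\<bar> powr r)"
    by (intro sum_mono2) auto
  finally have "(real (card S) * c powr r) powr (1 / r) \<le> lp_norm q x"
    using finite unfolding finite(1) lp_norm_ereal by (intro powr_mono2) auto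
  then show ?thesis
    using assms finite by (simp add: powr_mult powr_powr one_ereal_def)
next
  case infinite
  obtain i where i: "i \<in> S" using assms by auto
  have "c \<le> \<bar>x $ i\<bar>" using i assms by auto
  also have "\<dots> \<le> lp_norm q x" using infinite by (simp add: lp_norm_def)
  finally show ?thesis using infinite assms by (simp add: card_eq_0_iff)
qed

section \<open>Keeping the largest coordinates\<close>

text \<open>
  Markov's inequality for the counting measure.
\<close>

lemma card_large_coordinates_le:
  fixes x :: "real ^ 'n::finite"
  assumes "1 \<le> p" and "0 < \<epsilon>" and "lp_norm (ereal p) x \<le> 1"
  shows "card {i. \<epsilon> \<le> \<bar>x $ i\<bar>} \<le> min (nat \<lfloor>\<epsilon> powr (- p)\<rfloor>) CARD('n)"
proof -
  let ?S = "{i. \<epsilon> \<le> \<bar>x $ i\<bar>}"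
  have "real (card ?S) * \<epsilon> powr p = (\<Sum>i\<in>?S. \<epsilon> powr p)" by simp
  also have "\<dots> \<le> (\<Sum>i\<in>?S. \<bar>x $ i\<bar> powr p)"
    using assms by (intro sum_mono powr_mono2) auto
  also have "\<dots> \<le> (\<Sum>i\<in>UNIV. \<bar>x $ i\<bar> powr p)"
    by (intro sum_mono2) auto
  also have "\<dots> \<le> 1"
    using assms lp_norm_ereal_le_iff[of p 1 x] by simp
  finally have "real (card ?S) \<le> \<epsilon> powr (- p)"
    using assms by (simp add: powr_minus field_simps)
  then have "card ?S \<le> nat \<lfloor>\<epsilon> powr (- p)\<rfloor>"
    by (simp add: le_nat_floor)
  then show ?thesis by (simp add: card_mono)
qed

lemma exponent_ratio_eq:
  assumes "1 \<le> p" and "ereal p < q"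
  shows "1 \<le> q" and "0 \<le> real_of_ereal (1 / q)" and "real_of_ereal (1 / q) \<le> 1"
    and "real_of_ereal (ereal p / q) = p * real_of_ereal (1 / q)"
  using assms by (cases q; simp add: one_ereal_def)+

text \<open>
  Here \<open>z\<close> is an arbitrary approximation of \<open>x\<close>. The right-hand side depends on \<open>z\<close> only
  through its uniform error, and affinely, so that the bound survives taking expectations.
\<close>

lemma keep_largest_error_le:
  fixes x z :: "real ^ 'n::finite"
  assumes p: "1 \<le> p" and pq: "ereal p < q" and \<epsilon>: "0 < \<epsilon>" and x: "lp_norm (ereal p) x \<le> 1"
    and J: "card J = min (nat \<lfloor>\<epsilon> powr (- p)\<rfloor>) CARD('n)"
    and top: "\<And>i j. i \<in> J \<Longrightarrow> j \<notin> J \<Longrightarrow> \<bar>z $ j\<bar> \<le> \<bar>z $ i\<bar>"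
  shows "lp_norm q (x - (\<chi> i. if i \<in> J then z $ i else 0))
    \<le> \<epsilon> powr (1 - real_of_ereal (ereal p / q))
      + 4 * \<epsilon> powr (- real_of_ereal (ereal p / q)) * lp_norm \<infinity> (x - z)"
proof -
  define \<delta> where "\<delta> = lp_norm \<infinity> (x - z)"
  define s where "s = real_of_ereal (1 / q)"
  define S where "S = {i. \<epsilon> \<le> \<bar>x $ i\<bar>}"
  have q: "1 \<le> q" and s: "0 \<le> s" "s \<le> 1" "real_of_ereal (ereal p / q) = p * s"
    using exponent_ratio_eq[OF p pq] by (auto simp: s_def)
  have \<delta>0: "0 \<le> \<delta>" by (simp add: \<delta>_def lp_norm_nonneg)
  have \<delta>: "\<bar>x $ i - z $ i\<bar> \<le> \<delta>" for i
    using lp_norm_infinity_le_iff[of "x - z" \<delta>] by (simp add: \<delta>_def)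
  have S: "card S \<le> card J"
    unfolding S_def J using p \<epsilon> x by (rule card_large_coordinates_le)
  define v :: "real ^ 'n" where "v = (\<chi> i. min \<bar>x $ i\<bar> \<epsilon>)"
  define u :: "real ^ 'n" where "u = (\<chi> i. if i \<in> J \<union> S then 2 * \<delta> else 0)"
  \<comment> \<open>\<open>v\<close> is the modulus of \<open>x\<close> cut off at level \<open>\<epsilon>\<close>, and \<open>u\<close> pays for the noise on the retained
    coordinates and on the large coordinates that were wrongly discarded.\<close>
  have coord: "\<bar>(x - (\<chi> i. if i \<in> J then z $ i else 0)) $ i\<bar> \<le> \<bar>(v + u) $ i\<bar>" for i
  proof -
    have vu: "\<bar>(v + u) $ i\<bar> = min \<bar>x $ i\<bar> \<epsilon> + (if i \<in> J \<union> S then 2 * \<delta> else 0)"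
      using \<epsilon> \<delta>0 by (simp add: v_def u_def)
    consider "i \<in> J" | "i \<notin> J" "i \<notin> S" | "i \<notin> J" "i \<in> S" by auto
    then show ?thesis
    proof cases
      case 1
      then show ?thesis using \<delta>[of i] \<delta>0 \<epsilon> unfolding vu by simp
    next
      case 2
      then show ?thesis unfolding vu S_def by simp
    next
      case 3
      \<comment> \<open>A large coordinate can be discarded only in favour of a small one: otherwise \<open>J \<subseteq> S\<close>,
        and \<open>card S \<le> card J\<close> would give \<open>J = S\<close>.\<close>
      obtain j where j: "j \<in> J" "j \<notin> S"
        using 3 S card_seteq[of S J] by auto
      have "\<bar>x $ i\<bar> \<le> \<bar>z $ i\<bar> + \<delta>" using \<delta>[of i] by linarith
      also have "\<dots> \<le> \<bar>z $ j\<bar> + \<delta>" using top[OF j(1) 3(1)] by simp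
      also have "\<dots> \<le> \<bar>x $ j\<bar> + 2 * \<delta>" using \<delta>[of j] by linarith
      also have "\<dots> \<le> \<epsilon> + 2 * \<delta>" using j(2) by (simp add: S_def)
      finally show ?thesis using 3 unfolding vu S_def by simp
    qed
  qed
  have v: "lp_norm q v \<le> \<epsilon> powr (1 - real_of_ereal (ereal p / q))"
  proof (rule lp_norm_interpolation[OF p pq \<epsilon>])
    have "lp_norm (ereal p) v \<le> lp_norm (ereal p) x"
      using p \<epsilon> by (intro lp_norm_mono) (auto simp: v_def one_ereal_def)
    then show "lp_norm (ereal p) v \<le> 1" using x by simp
  qed (use \<epsilon> in \<open>simp add: v_def\<close>)
  have "lp_norm q u \<le> real (card (J \<union> S)) powr s * (2 * \<delta>)"
    unfolding s_def using \<delta>0 by (intro lp_norm_supported_le[OF q]) (auto simp: u_def)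
  also have "\<dots> \<le> (2 * \<epsilon> powr (- (p * s))) * (2 * \<delta>)"
  proof (intro mult_right_mono)
    have "real (card J) \<le> \<epsilon> powr (- p)"
      using J of_nat_floor[of "\<epsilon> powr (- p)"] by (simp add: of_nat_min min.coboundedI1)
    then have "real (card (J \<union> S)) \<le> 2 * \<epsilon> powr (- p)"
      using S card_Un_le[of J S] by linarith
    then have "real (card (J \<union> S)) powr s \<le> (2 * \<epsilon> powr (- p)) powr s"
      using s by (intro powr_mono2) auto
    also have "\<dots> = 2 powr s * \<epsilon> powr (- (p * s))"
      using \<epsilon> by (simp add: powr_mult powr_powr)
    also have "\<dots> \<le> 2 powr 1 * \<epsilon> powr (- (p * s))"
      using s by (intro mult_right_mono powr_mono) auto
    finally show "real (card (J \<union> S)) powr s \<le> 2 * \<epsilon> powr (- (p * s))" by simp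
  qed (use \<delta>0 in simp)
  finally have u: "lp_norm q u \<le> 4 * \<epsilon> powr (- real_of_ereal (ereal p / q)) * \<delta>"
    unfolding s(3) by simp
  show ?thesis
    using lp_norm_mono[OF q coord] lp_norm_triangle[OF q, of v u] u v
    unfolding \<delta>_def by linarith
qed

section \<open>A vector that is far from all sparse vectors\<close>

text \<open>
  The vector is constant on \<open>2 * k + 1\<close> coordinates and has \<open>p\<close>-norm \<open>1\<close>. A vector supported on
  \<open>k\<close> coordinates leaves at least \<open>k + 1 \<ge> \<epsilon> powr (- p)\<close> of these entries untouched, and each
  entry is at least \<open>\<epsilon> / 3\<close>, since \<open>k \<ge> 1\<close> gives \<open>2 * k + 1 \<le> 3 * k \<le> 3 * \<epsilon> powr (- p)\<close>. The
  vector is chosen before the support \<open>J\<close>, so one vector defeats all random elements at once.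
\<close>

lemma sparse_approximation_error_ge:
  assumes p: "1 \<le> p" and pq: "ereal p < q" and k: "1 \<le> k" "2 * k + 1 \<le> CARD('n::finite)"
    and lo: "real k \<le> \<epsilon> powr (- p)" and hi: "\<epsilon> powr (- p) \<le> real (k + 1)"
    and \<epsilon>: "0 < \<epsilon>"
  obtains x :: "real ^ 'n" where "lp_norm (ereal p) x \<le> 1"
    and "\<And>J w. card J = k \<Longrightarrow> (\<And>i. i \<notin> J \<Longrightarrow> w $ i = 0) \<Longrightarrow>
      1 / 3 * \<epsilon> powr (1 - real_of_ereal (ereal p / q)) \<le> lp_norm q (x - w)"
proof -
  define s where "s = real_of_ereal (1 / q)"
  have q: "1 \<le> q" and s: "0 \<le> s" "real_of_ereal (ereal p / q) = p * s"
    using exponent_ratio_eq[OF p pq] by (auto simp: s_def)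
  obtain T :: "'n set" where T: "card T = 2 * k + 1"
    using obtain_subset_with_card_n[OF k(2)] by auto
  define c where "c = real (2 * k + 1) powr (- (1 / p))"
  define x :: "real ^ 'n" where "x = (\<chi> i. if i \<in> T then c else 0)"
  have c0: "0 \<le> c" by (simp add: c_def)
  have "lp_norm (ereal p) x \<le> real (card T) powr real_of_ereal (1 / ereal p) * c"
    using p c0 by (intro lp_norm_supported_le) (auto simp: x_def one_ereal_def)
  also have "\<dots> = real (2 * k + 1) powr (1 / p + - (1 / p))"
    unfolding T c_def powr_add by (simp add: one_ereal_def)
  finally have x: "lp_norm (ereal p) x \<le> 1" by simp
  have c: "1 / 3 * \<epsilon> \<le> c"
  proof -
    have "(1 / 3 * \<epsilon>) powr p \<le> 1 / 3 * \<epsilon> powr p"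
      using p \<epsilon> powr_mono'[of 1 p "1 / 3 :: real"] unfolding powr_mult
      by (intro mult_right_mono) auto
    also have "\<dots> = 1 / (3 * \<epsilon> powr (- p))" using \<epsilon> by (simp add: powr_minus field_simps)
    also have "\<dots> \<le> 1 / real (2 * k + 1)"
      using lo k \<epsilon> by (intro divide_left_mono) auto
    also have "\<dots> = c powr p"
      unfolding c_def powr_powr using p by (simp add: powr_minus_divide)
    finally show ?thesis
      using p \<epsilon> c0 powr_less_mono2[of p c "1 / 3 * \<epsilon>"]
      by (meson less_le_trans not_le zero_less_one order_less_irrefl)
  qed
  show thesis
  proof (rule that[OF x])
    fix J :: "'n set" and w :: "real ^ 'n"
    assume J: "card J = k" and w: "\<And>i. i \<notin> J \<Longrightarrow> w $ i = 0"
    have TJ: "k + 1 \<le> card (T - J)"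
      using T J diff_card_le_card_Diff[of J T] by simp
    then have nonempty: "T - J \<noteq> {}" by force
    have "1 / 3 * \<epsilon> powr (1 - real_of_ereal (ereal p / q)) = (\<epsilon> powr (- p)) powr s * (1 / 3 * \<epsilon>)"
      using \<epsilon> unfolding s(2) powr_powr by (simp add: powr_diff powr_minus field_simps)
    also have "\<dots> \<le> real (card (T - J)) powr s * c"
      using hi TJ s(1) c \<epsilon> by (intro mult_mono powr_mono2) auto
    also have "\<dots> \<le> lp_norm q (x - w)"
      unfolding s_def using c0 nonempty w
      by (intro lp_norm_ge_on_set[OF q]) (auto simp: x_def)
    finally show "1 / 3 * \<epsilon> powr (1 - real_of_ereal (ereal p / q)) \<le> lp_norm q (x - w)" .
  qed
qed

section \<open>The denoised algorithm\<close>

lemma denoise_transcript: "transcript (denoise I A) \<omega> x i = transcript A \<omega> x i"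
  by (induction i) (auto simp: denoise_def split: option.split)

lemma denoise_query: "query (denoise I A) = query A"
  by (simp add: denoise_def)

lemma denoise_num_evals: "num_evals (denoise I A) = num_evals A"
  by (simp add: num_evals_def denoise_transcript denoise_query fun_eq_iff)

lemma denoise_run:
  "run (denoise I A) \<omega> x = (\<chi> i. if i \<in> I (run A \<omega> x) then run A \<omega> x $ i else 0)"
  unfolding run_def denoise_transcript denoise_num_evals by (simp add: denoise_def Let_def)

lemma denoise_randomized_algorithm:
  assumes A: "randomized_algorithm M A" and I: "I \<in> measurable borel (count_space UNIV)"
  shows "randomized_algorithm M (denoise I A)"
proof -
  have "(\<lambda>\<omega>. run (denoise I A) \<omega> x) \<in> borel_measurable M" for x
  proof -
    have run [measurable]: "(\<lambda>\<omega>. run A \<omega> x) \<in> borel_measurable M"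
      using A by (simp add: randomized_algorithm_def)
    have sel [measurable]: "(\<lambda>\<omega>. I (run A \<omega> x)) \<in> measurable M (count_space UNIV)"
      using I by measurable
    have "(\<lambda>\<omega>. if i \<in> I (run A \<omega> x) then run A \<omega> x $ i else 0) \<in> borel_measurable M" for i
    proof -
      have [measurable]: "(\<lambda>\<omega>. run A \<omega> x $ i) \<in> borel_measurable M"
        using run by (rule measurable_compose) simp
      have [measurable]: "Measurable.pred M (\<lambda>\<omega>. i \<in> I (run A \<omega> x))"
        using sel by (rule measurable_compose) simp
      show ?thesis by measurable
    qed
    then show ?thesis
      unfolding denoise_run
      by (subst borel_measurable_euclidean_space) (auto simp: Basis_vec_def inner_axis)
  qed
  then show ?thesis
    using A by (simp add: randomized_algorithm_def denoise_transcript denoise_query)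
qed

lemma borel_measurable_sup_error:
  assumes "randomized_algorithm M A"
  shows "(\<lambda>\<omega>. lp_norm \<infinity> (x - run A \<omega> x)) \<in> borel_measurable M"
proof -
  have "(\<lambda>\<omega>. run A \<omega> x) \<in> borel_measurable M"
    using assms by (simp add: randomized_algorithm_def)
  then have [measurable]: "(\<lambda>\<omega>. run A \<omega> x $ i) \<in> borel_measurable M" for i
    by (rule measurable_compose) simp
  have "(\<lambda>\<omega>. Max ((\<lambda>i. \<bar>x $ i - run A \<omega> x $ i\<bar>) ` UNIV)) \<in> borel_measurable M"
    by (rule borel_measurable_Max) auto
  then show ?thesis by (simp add: lp_norm_def)
qed

lemma top_selection_le:
  assumes "top_selection k I" and "i \<in> I z" and "j \<notin> I z"
  shows "\<bar>z $ j\<bar> \<le> \<bar>z $ i\<bar>"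
proof -
  have "ereal \<bar>z $ j\<bar> \<le> (SUP i\<in>- I z. ereal \<bar>z $ i\<bar>)" using assms by (intro SUP_upper) auto
  also have "\<dots> \<le> (INF i\<in>I z. ereal \<bar>z $ i\<bar>)" using assms by (simp add: top_selection_def)
  also have "\<dots> \<le> ereal \<bar>z $ i\<bar>" using assms by (intro INF_lower) auto
  finally show ?thesis by simp
qed

theorem lemma4p3:
  fixes M :: "'w measure"
    and A :: "('w, 'n::finite) alg"
    and p C \<epsilon> :: real
    and q :: ereal
    and k :: nat
    and I :: "real ^ 'n \<Rightarrow> 'n set"
  assumes "1 \<le> p" and "ereal p < q"
    and "randomized_algorithm M A"
    and "1 \<le> C" and "0 < \<epsilon>"
    and "alg_error M A (ereal p) \<infinity> \<le> ennreal (C * \<epsilon>)"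
    and "k = min (nat \<lfloor>\<epsilon> powr (- p)\<rfloor>) CARD('n)"
    and "top_selection k I"
  shows "(I \<in> measurable borel (count_space UNIV) \<longrightarrow> randomized_algorithm M (denoise I A))
    \<and> (1 \<le> k \<and> 2 * k + 1 \<le> CARD('n) \<longrightarrow>
        ennreal (1 / 3 * \<epsilon> powr (1 - real_of_ereal (ereal p / q)))
          \<le> alg_error M (denoise I A) (ereal p) q)
    \<and> alg_error M (denoise I A) (ereal p) q
        \<le> ennreal ((1 + 5 * C) * \<epsilon> powr (1 - real_of_ereal (ereal p / q)))
    \<and> alg_card M (denoise I A) = alg_card M A"
proof -
  interpret prob_space M using assms(3) by (simp add: randomized_algorithm_def)
  define \<theta> where "\<theta> = real_of_ereal (ereal p / q)"
  have card_I: "card (I z) = k" for z using assms(8) by (simp add: top_selection_def)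
  have lower: "ennreal (1 / 3 * \<epsilon> powr (1 - \<theta>)) \<le> alg_error M (denoise I A) (ereal p) q"
    if k: "1 \<le> k" "2 * k + 1 \<le> CARD('n)"
  proof -
    have k_eq: "k = nat \<lfloor>\<epsilon> powr (- p)\<rfloor>" using k assms(7) by auto
    have "real k \<le> \<epsilon> powr (- p)" "\<epsilon> powr (- p) \<le> real (k + 1)"
      unfolding k_eq using of_nat_floor[of "\<epsilon> powr (- p)"] by auto linarith
    then obtain x :: "real ^ 'n" where x: "lp_norm (ereal p) x \<le> 1"
      and far: "\<And>J w. card J = k \<Longrightarrow> (\<And>i. i \<notin> J \<Longrightarrow> w $ i = 0) \<Longrightarrow>
        1 / 3 * \<epsilon> powr (1 - \<theta>) \<le> lp_norm q (x - w)"
      using sparse_approximation_error_ge[OF assms(1,2) k] assms(5) unfolding \<theta>_def by metis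
    have "ennreal (1 / 3 * \<epsilon> powr (1 - \<theta>)) = (\<integral>\<^sup>+\<omega>. ennreal (1 / 3 * \<epsilon> powr (1 - \<theta>)) \<partial>M)"
      by (simp add: emeasure_space_1)
    also have "\<dots> \<le> (\<integral>\<^sup>+\<omega>. ennreal (lp_norm q (x - run (denoise I A) \<omega> x)) \<partial>M)"
    proof (intro nn_integral_mono ennreal_leI)
      show "1 / 3 * \<epsilon> powr (1 - \<theta>) \<le> lp_norm q (x - run (denoise I A) \<omega> x)" for \<omega>
        by (rule far[OF card_I[of "run A \<omega> x"]]) (simp add: denoise_run)
    qed
    also have "\<dots> \<le> alg_error M (denoise I A) (ereal p) q"
      unfolding alg_error_def using x by (intro SUP_upper) simp
    finally show ?thesis .
  qed
  \<comment> \<open>The integrand on the left may be nonmeasurable, but the bound from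
    \<open>keep_largest_error_le\<close> is measurable, and monotonicity holds for lower integrals.\<close>
  have upper: "alg_error M (denoise I A) (ereal p) q \<le> ennreal ((1 + 5 * C) * \<epsilon> powr (1 - \<theta>))"
    unfolding alg_error_def
  proof (rule SUP_least)
    fix x :: "real ^ 'n" assume "x \<in> {x. lp_norm (ereal p) x \<le> 1}"
    then have x: "lp_norm (ereal p) x \<le> 1" by simp
    define \<delta> where "\<delta> \<omega> = lp_norm \<infinity> (x - run A \<omega> x)" for \<omega>
    have [measurable]: "\<delta> \<in> borel_measurable M"
      unfolding \<delta>_def using assms(3) by (rule borel_measurable_sup_error)
    have \<delta>0: "0 \<le> \<delta> \<omega>" for \<omega> by (simp add: \<delta>_def lp_norm_nonneg)
    have "(\<integral>\<^sup>+\<omega>. ennreal (\<delta> \<omega>) \<partial>M) \<le> alg_error M A (ereal p) \<infinity>"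
      unfolding alg_error_def \<delta>_def using x by (intro SUP_upper) simp
    then have \<delta>_int: "(\<integral>\<^sup>+\<omega>. ennreal (\<delta> \<omega>) \<partial>M) \<le> ennreal (C * \<epsilon>)"
      using assms(6) by simp
    have "(\<integral>\<^sup>+\<omega>. ennreal (lp_norm q (x - run (denoise I A) \<omega> x)) \<partial>M)
        \<le> (\<integral>\<^sup>+\<omega>. ennreal (\<epsilon> powr (1 - \<theta>)) + ennreal (4 * \<epsilon> powr (- \<theta>)) * ennreal (\<delta> \<omega>) \<partial>M)"
    proof (intro nn_integral_mono)
      fix \<omega>
      have "lp_norm q (x - run (denoise I A) \<omega> x) \<le> \<epsilon> powr (1 - \<theta>) + 4 * \<epsilon> powr (- \<theta>) * \<delta> \<omega>"
        unfolding denoise_run \<theta>_def \<delta>_def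
        using assms(1,2,5) x card_I assms(7) top_selection_le[OF assms(8)]
        by (intro keep_largest_error_le) auto
      then show "ennreal (lp_norm q (x - run (denoise I A) \<omega> x))
          \<le> ennreal (\<epsilon> powr (1 - \<theta>)) + ennreal (4 * \<epsilon> powr (- \<theta>)) * ennreal (\<delta> \<omega>)"
        using \<delta>0 by (simp flip: ennreal_mult ennreal_plus add: ennreal_leI)
    qed
    also have "\<dots> = ennreal (\<epsilon> powr (1 - \<theta>)) + ennreal (4 * \<epsilon> powr (- \<theta>)) * (\<integral>\<^sup>+\<omega>. ennreal (\<delta> \<omega>) \<partial>M)"
      by (subst nn_integral_add) (auto simp: nn_integral_cmult emeasure_space_1)
    also have "\<dots> \<le> ennreal (\<epsilon> powr (1 - \<theta>)) + ennreal (4 * \<epsilon> powr (- \<theta>)) * ennreal (C * \<epsilon>)"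
      by (intro add_left_mono mult_left_mono \<delta>_int) simp
    also have "\<dots> = ennreal (\<epsilon> powr (1 - \<theta>) + 4 * \<epsilon> powr (- \<theta>) * (C * \<epsilon>))"
      using assms(4,5) by (simp flip: ennreal_mult ennreal_plus)
    also have "\<epsilon> powr (1 - \<theta>) + 4 * \<epsilon> powr (- \<theta>) * (C * \<epsilon>) = (1 + 4 * C) * \<epsilon> powr (1 - \<theta>)"
      using assms(5) by (simp add: powr_diff powr_minus field_simps)
    also have "ennreal \<dots> \<le> ennreal ((1 + 5 * C) * \<epsilon> powr (1 - \<theta>))"
      using assms(4) by (intro ennreal_leI mult_right_mono) auto
    finally show "(\<integral>\<^sup>+\<omega>. ennreal (lp_norm q (x - run (denoise I A) \<omega> x)) \<partial>M)
        \<le> ennreal ((1 + 5 * C) * \<epsilon> powr (1 - \<theta>))" .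
  qed
  have "alg_card M (denoise I A) = alg_card M A"
    by (simp add: alg_card_def denoise_num_evals)
  then show ?thesis
    using lower upper denoise_randomized_algorithm[OF assms(3)] unfolding \<theta>_def by blast
qed

end
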